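(* Let $e\in(0,1)$ be arbitrary and let $\chi\in\{0,1\}$ ($\chi=0$: spin-orbit problem; $\chi=1$: spin-spin problem). Consider the averaged conservative Keplerian model in the $(3:2,3:2)$ resonance, linearized at the critical point $(\varphi_1,\varphi_2,J_1,J_2)=(0,0,0,0)$, that is, the linear system in $(\xi_1,\xi_2,J_1,J_2)\in\mathbb{R}^4$ $$\dot\xi_1=\frac{2}{C_1}J_1,\qquad \dot\xi_2=\frac{2}{C_2}J_2,$$ $$\dot J_1=-\{K_1+\chi(K_2+2K_3+K_4+K_5)\}\,\xi_1-\chi(K_4-K_5)\,\xi_2,$$ $$\dot J_2=-\chi(L_4-L_5)\,\xi_1-\{L_1+\chi(L_2+2L_3+L_4+L_5)\}\,\xi_2,$$ where the constants are $$K_1=\frac{21d_1eGM_2}{4a^3},\quad L_1=\frac{21d_2eGM_1}{4a^3},$$ $$K_2=\frac{675d_1eGM_2q_1}{112a^5M_1}+\frac{135d_1eGq_2}{16a^5},\quad L_2=\frac{675d_2eGM_1q_2}{112a^5M_2}+\frac{135d_2eGq_1}{16a^5},$$ $$K_3=\frac{3825d_1^2e^2GM_2}{32a^5M_1},\quad L_3=\frac{3825d_2^2e^2GM_1}{32a^5M_2},$$ $$K_4=L_4=\frac{5355d_1d_2e^2G}{32a^5},\quad K_5=L_5=\frac{45d_1d_2e^2G}{16a^5}+\frac{9d_1d_2G}{16a^5}.$$ Then, both for $\chi=0$ and for $\chi=1$, all eigenvalues of the $4\times4$ coefficient matrix of this system are purely imaginary.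
   Context: Two ellipsoids $\mathcal E_1,\mathcal E_2$ with masses $M_1,M_2>0$ and principal moments of inertia $A_j\le B_j\le C_j$ ($j=1,2$), $C_j>0$, move on a Keplerian orbit with semimajor axis $a>0$ and eccentricity $e$; their spin axes are perpendicular to the orbital plane. Units are normalized so that $M_1+M_2=1$, $C_1+C_2=1$, the orbital period is $2\pi$, and the gravitational constant is $G=a^3>0$. Put $d_j=B_j-A_j$ and $q_j=2C_j-B_j-A_j$; it is assumed that $0<d_j\le C_j$, and $d_j\le q_j\le 2C_j$. If $\theta_j$ are the rotation angles, the resonant angles for the $(3:2,3:2)$ resonance are $\varphi_j=2\theta_j-3t$. The averaged conservative equations are $\dot\varphi_1=\frac{2}{C_1}J_1$, $\dot\varphi_2=\frac{2}{C_2}J_2$, $\dot J_1=-K_1\sin\varphi_1-\chi\{K_2\sin\varphi_1+K_3\sin2\varphi_1+K_4\sin(\varphi_1+\varphi_2)+K_5\sin(\varphi_1-\varphi_2)\}$, $\dot J_2=-L_1\sin\varphi_2-\chi\{L_2\sin\varphi_2+L_3\sin2\varphi_2+L_4\sin(\varphi_1+\varphi_2)-L_5\sin(\varphi_1-\varphi_2)\}$. A complex number is called purely imaginary if it is nonzero with zero real part. *)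

theory Defs
  imports "Jordan_Normal_Form.Char_Poly" "HOL-Analysis.Product_Vector"
begin

text \<open>
  The constants $K_1,\dots,K_5$ and $L_1,\dots,L_5$ are passed as functions
  \<open>K, L :: nat \<Rightarrow> real\<close>, of which only the values at the indices 1 to 5 are used.
  Phase space variables are ordered as $(\varphi_1,\varphi_2,J_1,J_2)$.
\<close>

definition averaged_field ::
  "real \<Rightarrow> real \<Rightarrow> real \<Rightarrow> (nat \<Rightarrow> real) \<Rightarrow> (nat \<Rightarrow> real)
    \<Rightarrow> real \<times> real \<times> real \<times> real \<Rightarrow> real \<times> real \<times> real \<times> real"
where
  "averaged_field C1 C2 \<chi> K L = (\<lambda>(\<phi>1, \<phi>2, J1, J2).
     (2 / C1 * J1,
      2 / C2 * J2,
      - K 1 * sin \<phi>1 - \<chi> * (K 2 * sin \<phi>1 + K 3 * sin (2 * \<phi>1)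
         + K 4 * sin (\<phi>1 + \<phi>2) + K 5 * sin (\<phi>1 - \<phi>2)),
      - L 1 * sin \<phi>2 - \<chi> * (L 2 * sin \<phi>2 + L 3 * sin (2 * \<phi>2)
         + L 4 * sin (\<phi>1 + \<phi>2) - L 5 * sin (\<phi>1 - \<phi>2))))"

definition linearized_matrix ::
  "real \<Rightarrow> real \<Rightarrow> real \<Rightarrow> (nat \<Rightarrow> real) \<Rightarrow> (nat \<Rightarrow> real) \<Rightarrow> real mat"
where
  "linearized_matrix C1 C2 \<chi> K L = mat_of_rows_list 4
     [[0, 0, 2 / C1, 0],
      [0, 0, 0, 2 / C2],
      [- (K 1 + \<chi> * (K 2 + 2 * K 3 + K 4 + K 5)), - \<chi> * (K 4 - K 5), 0, 0],
      [- \<chi> * (L 4 - L 5), - (L 1 + \<chi> * (L 2 + 2 * L 3 + L 4 + L 5)), 0, 0]]"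

definition purely_imaginary :: "complex \<Rightarrow> bool" where
  "purely_imaginary z \<longleftrightarrow> z \<noteq> 0 \<and> Re z = 0"

lemma averaged_field_critical_point: "averaged_field C1 C2 \<chi> K L (0, 0, 0, 0) = (0, 0, 0, 0)"
  by (simp add: averaged_field_def)

lemma linearized_matrix_mult_vec:
  "linearized_matrix C1 C2 \<chi> K L *\<^sub>v vec_of_list [\<xi>1, \<xi>2, J1, J2] = vec_of_list
     [2 / C1 * J1,
      2 / C2 * J2,
      - (K 1 + \<chi> * (K 2 + 2 * K 3 + K 4 + K 5)) * \<xi>1 - \<chi> * (K 4 - K 5) * \<xi>2,
      - \<chi> * (L 4 - L 5) * \<xi>1 - (L 1 + \<chi> * (L 2 + 2 * L 3 + L 4 + L 5)) * \<xi>2]"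
  (is "?l = ?r")
proof (rule eq_vecI)
  show "dim_vec ?l = dim_vec ?r"
    by (simp add: linearized_matrix_def mat_of_rows_list_def)
  fix i assume "i < dim_vec ?r"
  then have "i = 0 \<or> i = 1 \<or> i = 2 \<or> i = 3" by auto
  then show "?l $ i = ?r $ i"
    by (elim disjE)
      (simp_all add: linearized_matrix_def mat_of_rows_list_def scalar_prod_def
        numeral_eq_Suc vec_of_list_index algebra_simps)
qed

lemma averaged_field_has_derivative:
  "(averaged_field C1 C2 \<chi> K L has_derivative
     (\<lambda>(\<xi>1, \<xi>2, J1, J2).
        let v = linearized_matrix C1 C2 \<chi> K L *\<^sub>v vec_of_list [\<xi>1, \<xi>2, J1, J2]
        in (v $ 0, v $ 1, v $ 2, v $ 3))) (at (0, 0, 0, 0))"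
  unfolding averaged_field_def linearized_matrix_mult_vec case_prod_unfold
  by (rule derivative_eq_intros refl | simp)+
    (auto simp: fun_eq_iff Let_def numeral_eq_Suc vec_of_list_index algebra_simps)

end

theory Submission imports Defs begin

text \<open>
  Eliminating the momenta from the eigenvalue equation turns it into a symmetric generalized
  eigenvalue problem \<open>S x = - z\<^sup>2 D x\<close> with \<open>D = diag (C\<^sub>1/2, C\<^sub>2/2)\<close>, whose off-diagonal entry
  is \<open>\<chi> (K\<^sub>4 - K\<^sub>5)\<close>. Both diagonal entries exceed \<open>\<chi> (K\<^sub>4 + K\<^sub>5)\<close>, as the remaining constants
  are positive, so \<open>S\<close> is strictly diagonally dominant and hence positive definite. Therefore
  \<open>z\<^sup>2\<close> is a negative real number.
\<close>

text \<open>The imaginary part of \<open>z\<^sup>2\<close> is \<open>2 * Re z * Im z\<close>, so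
  \<open>Re z\<close> or \<open>Im z\<close> vanishes. The real part is
  \<open>(Re z)\<^sup>2 - (Im z)\<^sup>2\<close>, whose negativity forces
  \<open>Im z \<noteq> 0\<close> and leaves only \<open>Re z = 0\<close>.\<close>

lemma purely_imaginaryI_square:
  assumes "z\<^sup>2 = complex_of_real r" and "r < 0"
  shows "purely_imaginary z"
proof -
  have "Im (z\<^sup>2) = 0" "Re (z\<^sup>2) < 0" using assms by simp_all
  then have "Re z = 0 \<or> Im z = 0" "Re z * Re z < Im z * Im z"
    by (auto simp: power2_eq_square)
  moreover have "0 \<le> Re z * Re z" by simp
  ultimately have "Re z = 0" "Im z \<noteq> 0" by force+
  then show ?thesis unfolding purely_imaginary_def by auto
qed

text \<open>Bounding the cross term from below by
  \<open>- 2 * \<bar>k\<bar> * cmod x * cmod y\<close> and completing the square leaves \<open>(P -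
  \<bar>k\<bar>) * (cmod x)\<^sup>2 + (Q - \<bar>k\<bar>) * (cmod y)\<^sup>2\<close> plus
  \<open>\<bar>k\<bar> * (cmod x - cmod y)\<^sup>2\<close>.\<close>

lemma diagonally_dominant_form_pos:
  fixes P Q k :: real and x y :: complex
  assumes "\<bar>k\<bar> < P" and "\<bar>k\<bar> < Q" and "x \<noteq> 0 \<or> y \<noteq> 0"
  shows "0 < P * (cmod x)\<^sup>2 + Q * (cmod y)\<^sup>2 + 2 * k * Re (x * cnj y)"
proof -
  have "\<bar>k * Re (x * cnj y)\<bar> \<le> \<bar>k\<bar> * (cmod x * cmod y)"
    using abs_Re_le_cmod[of "x * cnj y"] by (simp add: abs_mult norm_mult mult_left_mono)
  moreover have "0 \<le> \<bar>k\<bar> * (cmod x - cmod y)\<^sup>2" by simp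
  moreover have "0 < (P - \<bar>k\<bar>) * (cmod x)\<^sup>2 + (Q - \<bar>k\<bar>) * (cmod y)\<^sup>2"
    using assms by (auto intro: add_pos_nonneg add_nonneg_pos)
  ultimately show ?thesis
    by (simp add: power2_diff algebra_simps)
qed

text \<open>Rayleigh quotient argument: pairing both equations with the conjugates of
  \<open>x1\<close> and \<open>x2\<close> and adding gives \<open>F = - z\<^sup>2 * N\<close> with
  \<open>F\<close> and \<open>N\<close> real and positive.\<close>

lemma generalized_eigenvalue_purely_imaginary:
  fixes P Q k c1 c2 :: real and x1 x2 z :: complex
  assumes "\<bar>k\<bar> < P" and "\<bar>k\<bar> < Q" and "c1 > 0" and "c2 > 0" and "x1 \<noteq> 0 \<or> x2 \<noteq> 0"
    and eq1: "P * x1 + k * x2 = - (z\<^sup>2 * c1 * x1)"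
    and eq2: "k * x1 + Q * x2 = - (z\<^sup>2 * c2 * x2)"
  shows "purely_imaginary z"
proof -
  \<comment> \<open>\<open>N\<close> and \<open>F\<close> are the Hermitian forms of the diagonal
    matrix with entries \<open>c1\<close>, \<open>c2\<close> and of the symmetric matrix with rows
    \<open>P\<close>, \<open>k\<close> and \<open>k\<close>, \<open>Q\<close>, both evaluated at the
    vector \<open>x1\<close>, \<open>x2\<close>.\<close>
  define N where "N = c1 * (cmod x1)\<^sup>2 + c2 * (cmod x2)\<^sup>2"
  define F where "F = P * (cmod x1)\<^sup>2 + Q * (cmod x2)\<^sup>2 + 2 * k * Re (x1 * cnj x2)"
  have "N > 0"
    unfolding N_def using assms(3-5) by (auto intro: add_pos_nonneg add_nonneg_pos)
  have "F > 0"
    unfolding F_def using assms by (intro diagonally_dominant_form_pos)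
  \<comment> \<open>Having the same \<open>k\<close> in both equations lets the two mixed terms
    combine into a real number.\<close>
  have Re: "of_real (2 * Re (x1 * cnj x2)) = x1 * cnj x2 + x2 * cnj x1"
    using complex_add_cnj[of "x1 * cnj x2"] by (simp add: mult.commute)
  have "of_real F = of_real P * (x1 * cnj x1) + of_real Q * (x2 * cnj x2)
      + of_real k * of_real (2 * Re (x1 * cnj x2))"
    unfolding F_def by (simp flip: complex_norm_square)
  also have "\<dots> = (P * x1 + k * x2) * cnj x1 + (k * x1 + Q * x2) * cnj x2"
    unfolding Re by (simp add: algebra_simps)
  also have "\<dots> = - (z\<^sup>2 * of_real N)"
    unfolding eq1 eq2 N_def by (simp add: complex_norm_square algebra_simps del: of_real_power)
  finally have "z\<^sup>2 = of_real (- F / N)"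
    using \<open>N > 0\<close> by (simp add: field_simps)
  then show ?thesis
    by (rule purely_imaginaryI_square) (use \<open>F > 0\<close> \<open>N > 0\<close> in simp)
qed

text \<open>The first two rows express the momentum components of an eigenvector as
  \<open>z * C1 / 2\<close> and \<open>z * C2 / 2\<close> times its angle components. Substituting
  this into the last two rows produces the factor \<open>z\<^sup>2\<close>.\<close>

lemma linearized_matrix_eigenvalueE:
  assumes "eigenvalue (map_mat complex_of_real (linearized_matrix C1 C2 \<chi> K L)) z"
    and "C1 > 0" and "C2 > 0"
  obtains x1 x2 where "x1 \<noteq> 0 \<or> x2 \<noteq> 0"
    and "of_real (K 1 + \<chi> * (K 2 + 2 * K 3 + K 4 + K 5)) * x1 + of_real (\<chi> * (K 4 - K 5)) * x2
      = - (z\<^sup>2 * of_real (C1 / 2) * x1)"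
    and "of_real (\<chi> * (L 4 - L 5)) * x1 + of_real (L 1 + \<chi> * (L 2 + 2 * L 3 + L 4 + L 5)) * x2
      = - (z\<^sup>2 * of_real (C2 / 2) * x2)"
proof -
  let ?A = "map_mat complex_of_real (linearized_matrix C1 C2 \<chi> K L)"
  define P where "P = K 1 + \<chi> * (K 2 + 2 * K 3 + K 4 + K 5)"
  define Q where "Q = L 1 + \<chi> * (L 2 + 2 * L 3 + L 4 + L 5)"
  define k where "k = \<chi> * (K 4 - K 5)"
  define l where "l = \<chi> * (L 4 - L 5)"
  have A: "linearized_matrix C1 C2 \<chi> K L = mat_of_rows_list 4
      [[0, 0, 2 / C1, 0], [0, 0, 0, 2 / C2], [- P, - k, 0, 0], [- l, - Q, 0, 0]]"
    unfolding linearized_matrix_def P_def Q_def k_def l_def by simp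
  have dim: "dim_row ?A = 4" "dim_col ?A = 4"
    unfolding A by (simp_all add: mat_of_rows_list_def)
  obtain v where v: "dim_vec v = 4" "v \<noteq> 0\<^sub>v 4" "?A *\<^sub>v v = z \<cdot>\<^sub>v v"
    using assms(1) dim unfolding eigenvalue_def eigenvector_def
    by (metis carrier_vecD)
  have row: "(\<Sum>j = 0..<4. ?A $$ (i, j) * v $ j) = z * v $ i" if "i < 4" for i
    using arg_cong[OF v(3), of "\<lambda>w. w $ i"] that v(1) dim
    by (simp add: scalar_prod_def)
  have r0: "of_real (2 / C1) * v $ 2 = z * v $ 0"
    using row[of 0] unfolding A by (simp add: mat_of_rows_list_def numeral_eq_Suc)
  have r1: "of_real (2 / C2) * v $ 3 = z * v $ 1"
    using row[of 1] unfolding A by (simp add: mat_of_rows_list_def numeral_eq_Suc)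
  have r2: "of_real P * v $ 0 + of_real k * v $ 1 = - (z * v $ 2)"
    using row[of 2] unfolding A
    by (simp add: mat_of_rows_list_def numeral_eq_Suc algebra_simps flip: equation_minus_iff)
  have r3: "of_real l * v $ 0 + of_real Q * v $ 1 = - (z * v $ 3)"
    using row[of 3] unfolding A
    by (simp add: mat_of_rows_list_def numeral_eq_Suc algebra_simps flip: equation_minus_iff)
  have v2: "v $ 2 = z * of_real (C1 / 2) * v $ 0" and v3: "v $ 3 = z * of_real (C2 / 2) * v $ 1"
    using r0 r1 assms(2,3) by (auto simp: field_simps)
  \<comment> \<open>If both angle components vanished, \<open>v2\<close> and \<open>v3\<close> would
    make the momenta vanish too, contradicting \<open>v \<noteq> 0\<close>.\<close>
  have "v $ 0 \<noteq> 0 \<or> v $ 1 \<noteq> 0"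
  proof (rule ccontr)
    assume "\<not> ?thesis"
    then have "v $ 0 = 0" "v $ 1 = 0" "v $ 2 = 0" "v $ 3 = 0" using v2 v3 by auto
    then have "v = 0\<^sub>v 4"
      using v(1) by (intro eq_vecI) (auto simp: less_Suc_eq numeral_eq_Suc)
    then show False using v(2) by simp
  qed
  then show thesis
    using r2 r3 unfolding v2 v3 P_def Q_def k_def l_def
    by (intro that) (simp_all add: power2_eq_square mult.assoc)
qed

theorem proposition8:
  fixes M1 M2 A1 A2 B1 B2 C1 C2 a e G d1 d2 q1 q2 \<chi> :: real
    and K L :: "nat \<Rightarrow> real"
  assumes "M1 > 0" and "M2 > 0" and "M1 + M2 = 1"
    and "A1 \<le> B1" and "B1 \<le> C1" and "C1 > 0"
    and "A2 \<le> B2" and "B2 \<le> C2" and "C2 > 0"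
    and "C1 + C2 = 1"
    and "a > 0" and "G = a ^ 3"
    and "d1 = B1 - A1" and "d2 = B2 - A2"
    and "q1 = 2 * C1 - B1 - A1" and "q2 = 2 * C2 - B2 - A2"
    and "0 < d1" and "d1 \<le> C1" and "d1 \<le> q1" and "q1 \<le> 2 * C1"
    and "0 < d2" and "d2 \<le> C2" and "d2 \<le> q2" and "q2 \<le> 2 * C2"
    and "0 < e" and "e < 1"
    and "\<chi> \<in> {0, 1}"
    and "K 1 = 21 * d1 * e * G * M2 / (4 * a ^ 3)"
    and "L 1 = 21 * d2 * e * G * M1 / (4 * a ^ 3)"
    and "K 2 = 675 * d1 * e * G * M2 * q1 / (112 * a ^ 5 * M1)
               + 135 * d1 * e * G * q2 / (16 * a ^ 5)"
    and "L 2 = 675 * d2 * e * G * M1 * q2 / (112 * a ^ 5 * M2)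
               + 135 * d2 * e * G * q1 / (16 * a ^ 5)"
    and "K 3 = 3825 * d1 ^ 2 * e ^ 2 * G * M2 / (32 * a ^ 5 * M1)"
    and "L 3 = 3825 * d2 ^ 2 * e ^ 2 * G * M1 / (32 * a ^ 5 * M2)"
    and "K 4 = 5355 * d1 * d2 * e ^ 2 * G / (32 * a ^ 5)"
    and "L 4 = K 4"
    and "K 5 = 45 * d1 * d2 * e ^ 2 * G / (16 * a ^ 5) + 9 * d1 * d2 * G / (16 * a ^ 5)"
    and "L 5 = K 5"
  shows "\<forall>z. eigenvalue (map_mat complex_of_real (linearized_matrix C1 C2 \<chi> K L)) z
             \<longrightarrow> purely_imaginary z"
proof (intro allI impI)
  fix z
  assume "eigenvalue (map_mat complex_of_real (linearized_matrix C1 C2 \<chi> K L)) z"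
  then obtain x1 x2 where x: "x1 \<noteq> 0 \<or> x2 \<noteq> 0"
    and eq1: "of_real (K 1 + \<chi> * (K 2 + 2 * K 3 + K 4 + K 5)) * x1
      + of_real (\<chi> * (K 4 - K 5)) * x2 = - (z\<^sup>2 * of_real (C1 / 2) * x1)"
    and eq2: "of_real (\<chi> * (L 4 - L 5)) * x1
      + of_real (L 1 + \<chi> * (L 2 + 2 * L 3 + L 4 + L 5)) * x2 = - (z\<^sup>2 * of_real (C2 / 2) * x2)"
    using \<open>C1 > 0\<close> \<open>C2 > 0\<close> by (rule linearized_matrix_eigenvalueE)
  have "G > 0" using \<open>G = a ^ 3\<close> \<open>a > 0\<close> by simp
  have "q1 > 0" "q2 > 0" using \<open>0 < d1\<close> \<open>d1 \<le> q1\<close> \<open>0 < d2\<close> \<open>d2 \<le> q2\<close> by linarith+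
  note pos = \<open>G > 0\<close> this \<open>a > 0\<close> \<open>0 < e\<close> \<open>0 < d1\<close> \<open>0 < d2\<close> \<open>M1 > 0\<close> \<open>M2 > 0\<close>
  have "K 1 > 0" "K 2 > 0" "K 3 > 0" "K 4 > 0" "K 5 > 0" "L 1 > 0" "L 2 > 0" "L 3 > 0"
    unfolding assms(28-34,36) using pos
    by (auto intro!: add_pos_pos divide_pos_pos mult_pos_pos zero_less_power)
  \<comment> \<open>For \<open>\<chi> = 0\<close> the left side is zero and \<open>K 1\<close>,
    \<open>L 1\<close> are positive. For \<open>\<chi> = 1\<close> positivity gives
    \<open>\<bar>K 4 - K 5\<bar> < K 4 + K 5\<close>, and the other summands on the right are
    positive.\<close>
  then have dom: "\<bar>\<chi> * (K 4 - K 5)\<bar> < K 1 + \<chi> * (K 2 + 2 * K 3 + K 4 + K 5)"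
    "\<bar>\<chi> * (K 4 - K 5)\<bar> < L 1 + \<chi> * (L 2 + 2 * L 3 + K 4 + K 5)"
    using \<open>\<chi> \<in> {0, 1}\<close> by auto
  \<comment> \<open>The equalities \<open>L 4 = K 4\<close> and \<open>L 5 = K 5\<close> make the
    coupling symmetric; the weights are \<open>C1 / 2\<close> and \<open>C2 / 2\<close>.\<close>
  show "purely_imaginary z"
    using \<open>C1 > 0\<close> \<open>C2 > 0\<close>
    by (intro generalized_eigenvalue_purely_imaginary
        [OF dom _ _ x eq1 eq2[unfolded \<open>L 4 = K 4\<close> \<open>L 5 = K 5\<close>]]) simp_all
qed

end
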